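(* Let $H$ be a finite simple graph that contains no induced subgraph isomorphic to $K_4-e$ (the complete graph on four vertices with one edge deleted) and no induced subgraph isomorphic to $K_{1,4}$. Then there exists a locally linear graph $G$ whose triangle graph $G^*$ is isomorphic to $H$, and this locally linear graph $G$ is unique up to isomorphism.
   Context: All graphs are finite, simple and undirected. A graph $G$ is locally linear if it has no isolated vertices and for every vertex $v$ the subgraph induced on its neighbourhood $N(v)=\{w\in V(G): w\sim v, w\neq v\}$ is $1$-regular; equivalently, every edge of $G$ lies in exactly one triangle (so two distinct triangles of $G$ share at most one vertex). The triangle graph $G^*$ of a locally linear graph $G$ is the graph whose vertex set is the set of triangles of $G$, two distinct triangles being adjacent in $G^*$ if and only if they share a common vertex in $G$. *)

theory Defs
  imports "Graph_Theory.Graph_Theory"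
begin

text \<open>
  Finite simple undirected graphs are the graphs satisfying \<^const>\<open>pair_graph\<close>: every undirected
  edge is represented by its two opposite arcs. The null graph is allowed.
\<close>

definition K4_minus_edge :: "'a pair_pre_digraph \<Rightarrow> bool" where
  "K4_minus_edge D \<longleftrightarrow> (\<exists>K :: 'a pair_pre_digraph. K\<^bsub>4\<^esub> (with_proj K) \<and>
     (\<exists>u v. (u, v) \<in> parcs K \<and> D = K\<lparr>parcs := parcs K - {(u, v), (v, u)}\<rparr>))"

definition neighbourhood :: "'a pair_pre_digraph \<Rightarrow> 'a \<Rightarrow> 'a set" where
  "neighbourhood G v = {w \<in> pverts G. (v, w) \<in> parcs G \<and> w \<noteq> v}"

text \<open>In a symmetric digraph the degree of a vertex as an undirected graph is its out-degree.\<close>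

definition regular :: "nat \<Rightarrow> ('a, 'b) pre_digraph \<Rightarrow> bool" where
  "regular k G \<longleftrightarrow> (\<forall>v \<in> verts G. out_degree G v = k)"

definition locally_linear :: "'a pair_pre_digraph \<Rightarrow> bool" where
  "locally_linear G \<longleftrightarrow> pair_graph G \<and>
     (\<forall>v \<in> pverts G. neighbourhood G v \<noteq> {} \<and> regular 1 (with_proj G \<restriction> neighbourhood G v))"

text \<open>A triangle is identified with its set of vertices.\<close>

definition triangles :: "'a pair_pre_digraph \<Rightarrow> 'a set set" where
  "triangles G = {T. T \<subseteq> pverts G \<and> K\<^bsub>3\<^esub> (with_proj G \<restriction> T)}"

definition triangle_graph :: "'a pair_pre_digraph \<Rightarrow> 'a set pair_pre_digraph" where
  "triangle_graph G =
     \<lparr>pverts = triangles G,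
      parcs = {(S, T). S \<in> triangles G \<and> T \<in> triangles G \<and> S \<noteq> T \<and> S \<inter> T \<noteq> {}}\<rparr>"

end

theory Submission
  imports Defs
begin

text \<open>
  A locally linear graph is the union of its triangles, which form a linear system of triples in
  which pairwise intersecting triples have a common point.

  Existence: since \<open>H\<close> has no induced \<open>K\<^sub>4 - e\<close>, every edge lies in a unique maximal clique
  (a ``line''), and since it has no induced \<open>K\<^sub>1\<^sub>,\<^sub>4\<close>, at most three lines pass through a vertex.
  Replace every vertex by the set of lines through it, padded to a triple by private points.

  Uniqueness: for a point \<open>x\<close> let its pencil be the set of triangles containing it. By the Helly
  property, the pencils with at least two members are determined by the triangle graph, and such a
  pencil determines its point. As every triangle has three points, the number of points with a
  one-element pencil is determined as well, so there is a pencil-preserving bijection of the points.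
\<close>

section \<open>Isomorphisms of graphs whose arcs are pairs\<close>

text \<open>An arc is the pair of its ends, so the arc map of an isomorphism is forced to be
  \<open>map_prod f f\<close>; an adjacency-preserving bijection of the vertices is enough.\<close>

lemma digraph_iso_pairI:
  assumes "pair_wf_digraph G" "pair_wf_digraph H"
    and bij: "bij_betw f (pverts G) (pverts H)"
    and arcs: "\<And>u v. u \<in> pverts G \<Longrightarrow> v \<in> pverts G \<Longrightarrow> (u, v) \<in> parcs G \<longleftrightarrow> (f u, f v) \<in> parcs H"
  shows "digraph_iso (with_proj G) (with_proj H)"
proof -
  interpret G: pair_wf_digraph G by fact
  interpret H: pair_wf_digraph H by fact
  let ?h = "\<lparr>iso_verts = f, iso_arcs = map_prod f f, iso_head = snd, iso_tail = fst\<rparr>"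
  have inj: "inj_on f (pverts G)" and img: "f ` pverts G = pverts H"
    using bij by (auto simp: bij_betw_def)
  have "inj_on (map_prod f f) (parcs G)"
    using G.wellformed' inj by (auto simp: inj_on_def)
  then have "pre_digraph.digraph_isomorphism (with_proj G) ?h"
    using inj G.wf_digraph by (auto simp: pre_digraph.digraph_isomorphism_def)
  moreover have "map_prod f f ` parcs G = parcs H"
  proof (intro subset_antisym subsetI)
    fix e assume "e \<in> map_prod f f ` parcs G"
    then obtain u v where "(u, v) \<in> parcs G" "e = (f u, f v)" by auto
    then show "e \<in> parcs H" using arcs[of u v] G.wellformed' by blast
  next
    fix e assume e: "e \<in> parcs H"
    obtain a b where ab: "e = (a, b)" by fastforce
    with e have "a \<in> f ` pverts G" "b \<in> f ` pverts G"
      using H.wellformed' img by blast+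
    then obtain u v where "u \<in> pverts G" "v \<in> pverts G" and uv: "a = f u" "b = f v"
      by blast
    then have "(u, v) \<in> parcs G" using arcs[of u v] e ab by simp
    then show "e \<in> map_prod f f ` parcs G" unfolding ab uv by (rule rev_image_eqI) simp
  qed
  then have "with_proj H = app_iso ?h (with_proj G)"
    using img by (simp add: app_iso_def with_proj_def)
  ultimately show ?thesis unfolding digraph_iso_def by blast
qed

lemma digraph_iso_pairE:
  assumes "digraph_iso (with_proj G) (with_proj H)"
  obtains f where "bij_betw f (pverts G) (pverts H)"
    and "\<And>u v. u \<in> pverts G \<Longrightarrow> v \<in> pverts G \<Longrightarrow> (u, v) \<in> parcs G \<longleftrightarrow> (f u, f v) \<in> parcs H"
proof -
  obtain h where iso: "pre_digraph.digraph_isomorphism (with_proj G) h"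
    and H: "with_proj H = app_iso h (with_proj G)"
    using assms unfolding digraph_iso_def by blast
  let ?f = "iso_verts h"
  have wf: "pair_wf_digraph G"
    using iso by (simp add: pre_digraph.digraph_isomorphism_def wf_digraph_wp_iff)
  interpret G: pair_wf_digraph G by fact
  have inj: "inj_on ?f (pverts G)"
    using iso by (simp add: pre_digraph.digraph_isomorphism_def)
  have sel: "pverts H = ?f ` pverts G" "parcs H = iso_arcs h ` parcs G"
    "iso_tail h = fst" "iso_head h = snd"
    using arg_cong[OF H, of verts] arg_cong[OF H, of arcs]
      arg_cong[OF H, of tail] arg_cong[OF H, of head] by simp_all
  \<comment> \<open>Since \<open>H\<close> has pairs as arcs, \<open>iso_tail h\<close> and
    \<open>iso_head h\<close> are the projections, which leaves no freedom for
    \<open>iso_arcs h\<close>.\<close>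
  have "iso_arcs h e = map_prod ?f ?f e" if "e \<in> parcs G" for e
    using iso that sel by (auto simp: pre_digraph.digraph_isomorphism_def prod_eq_iff)
  then have arcs: "parcs H = map_prod ?f ?f ` parcs G" using sel by simp
  show thesis
  proof (rule that[of ?f])
    show "bij_betw ?f (pverts G) (pverts H)" using inj sel by (simp add: bij_betw_def)
    fix u v assume uv: "u \<in> pverts G" "v \<in> pverts G"
    show "(u, v) \<in> parcs G \<longleftrightarrow> (?f u, ?f v) \<in> parcs H"
    proof
      assume "(?f u, ?f v) \<in> parcs H"
      then obtain a b where "(a, b) \<in> parcs G" "?f u = ?f a" "?f v = ?f b"
        using arcs by auto
      then show "(u, v) \<in> parcs G" using inj_onD[OF inj] uv G.wellformed' by metis
    qed (force simp: arcs)
  qed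
qed

section \<open>Elementary forms of local linearity and of triangles\<close>

lemma pair_graph_iff:
  "pair_graph G \<longleftrightarrow> finite (pverts G) \<and> parcs G \<subseteq> pverts G \<times> pverts G \<and> sym (parcs G) \<and> irrefl (parcs G)"
proof
  assume "pair_graph G"
  then interpret pair_graph G .
  show "finite (pverts G) \<and> parcs G \<subseteq> pverts G \<times> pverts G \<and> sym (parcs G) \<and> irrefl (parcs G)"
    using pair_finite_verts wellformed' arcs_symmetric
    by (auto simp: irrefl_def intro!: symI dest: no_loops')
next
  assume A: "finite (pverts G) \<and> parcs G \<subseteq> pverts G \<times> pverts G \<and> sym (parcs G) \<and> irrefl (parcs G)"
  then have "finite (parcs G)" by (meson finite_SigmaI finite_subset)
  with A show "pair_graph G"
    by unfold_locales (auto simp: symmetric_def irrefl_def)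
qed

text \<open>The out-degree of \<open>w\<close> inside the neighbourhood of \<open>v\<close> counts
  the common neighbours of \<open>v\<close> and \<open>w\<close>, so 1-regularity means that each
  edge lies in exactly one triangle.\<close>

lemma locally_linear_iff:
  "locally_linear G \<longleftrightarrow> pair_graph G \<and> (\<forall>v \<in> pverts G. \<exists>w. (v, w) \<in> parcs G) \<and>
     (\<forall>u v. (u, v) \<in> parcs G \<longrightarrow> (\<exists>!w. (u, w) \<in> parcs G \<and> (v, w) \<in> parcs G))"
proof (cases "pair_graph G")
  case True
  then interpret pair_graph G .
  have nb: "neighbourhood G v = {w. (v, w) \<in> parcs G}" for v
    using wellformed' by (auto simp: neighbourhood_def dest: no_loops')
  have deg: "out_degree (with_proj G \<restriction> neighbourhood G v) w = 1 \<longleftrightarrow>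
      (\<exists>!x. (v, x) \<in> parcs G \<and> (w, x) \<in> parcs G)" if "(v, w) \<in> parcs G" for v w
  proof -
    have "out_arcs (with_proj G \<restriction> neighbourhood G v) w =
        Pair w ` {x. (v, x) \<in> parcs G \<and> (w, x) \<in> parcs G}"
      using that by (auto simp: out_arcs_def nb)
    then have "out_degree (with_proj G \<restriction> neighbourhood G v) w =
        card {x. (v, x) \<in> parcs G \<and> (w, x) \<in> parcs G}"
      by (simp add: out_degree_def card_image inj_on_def)
    then show ?thesis by (auto simp: card_1_singleton_iff set_eq_iff Ex1_def)
  qed
  show ?thesis
  proof -
    have "(\<forall>v \<in> pverts G. A v \<and> (\<forall>w. (v, w) \<in> parcs G \<longrightarrow> Q v w)) \<longleftrightarrow>
        (\<forall>v \<in> pverts G. A v) \<and> (\<forall>v w. (v, w) \<in> parcs G \<longrightarrow> Q v w)" for A Q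
      using wellformed'(1) by blast
    moreover have "neighbourhood G v \<noteq> {} \<longleftrightarrow> (\<exists>w. (v, w) \<in> parcs G)" for v
      by (auto simp: nb)
    moreover have "regular 1 (with_proj G \<restriction> neighbourhood G v) \<longleftrightarrow>
        (\<forall>w. (v, w) \<in> parcs G \<longrightarrow> (\<exists>!x. (v, x) \<in> parcs G \<and> (w, x) \<in> parcs G))" for v
      using deg[of v] by (simp add: regular_def nb)
    ultimately show ?thesis
      using True by (simp add: locally_linear_def)
  qed
qed (simp add: locally_linear_def)

text \<open>Three arcs suffice: the reverse arcs come from symmetry, and the corners are distinct
  because there are no loops.\<close>

lemma triangles_eq:
  assumes "pair_graph G"
  shows "triangles G = {{x, y, z} |x y z. (x, y) \<in> parcs G \<and> (y, z) \<in> parcs G \<and> (x, z) \<in> parcs G}"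
proof -
  interpret pair_graph G by fact
  have K3: "K\<^bsub>3\<^esub> (with_proj G \<restriction> T) \<longleftrightarrow> card T = 3 \<and>
      parcs G \<inter> T \<times> T = {(u, v). u \<in> T \<and> v \<in> T \<and> u \<noteq> v}" if "T \<subseteq> pverts G" for T
  proof -
    \<comment> \<open>The induced subgraph is rewritten as a pair digraph, the form to which
      \<open>complete_digraph_pair_def\<close> applies.\<close>
    let ?P = "\<lparr>pverts = T, parcs = {e \<in> parcs G. fst e \<in> T \<and> snd e \<in> T}\<rparr>"
    have eq: "with_proj G \<restriction> T = with_proj ?P"
      by (simp add: induce_subgraph_def with_proj_def)
    have "finite T" using that pair_finite_verts by (rule finite_subset)
    moreover have "parcs G \<inter> T \<times> T = {e \<in> parcs G. fst e \<in> T \<and> snd e \<in> T}" by auto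
    ultimately show ?thesis unfolding eq by (simp add: complete_digraph_pair_def)
  qed
  show ?thesis
  proof (intro subset_antisym subsetI)
    fix T assume "T \<in> triangles G"
    then have c: "card T = 3" and a: "parcs G \<inter> T \<times> T = {(u, v). u \<in> T \<and> v \<in> T \<and> u \<noteq> v}"
      using K3 by (auto simp: triangles_def)
    from c obtain x y z where T: "T = {x, y, z}" "x \<noteq> y" "y \<noteq> z" "x \<noteq> z"
      by (auto simp: card_3_iff)
    then have "{(x, y), (y, z), (x, z)} \<subseteq> parcs G \<inter> T \<times> T" unfolding a by auto
    with T show "T \<in> {{x, y, z} |x y z. (x, y) \<in> parcs G \<and> (y, z) \<in> parcs G \<and> (x, z) \<in> parcs G}"
      by blast
  next
    fix T assume "T \<in> {{x, y, z} |x y z. (x, y) \<in> parcs G \<and> (y, z) \<in> parcs G \<and> (x, z) \<in> parcs G}"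
    then obtain x y z where T: "T = {x, y, z}"
      and e: "(x, y) \<in> parcs G" "(y, z) \<in> parcs G" "(x, z) \<in> parcs G" by blast
    from e have ne: "x \<noteq> y" "y \<noteq> z" "x \<noteq> z" using no_loops' by blast+
    have "T \<subseteq> pverts G" using T e wellformed' by auto
    moreover have "card T = 3" using T ne by simp
    moreover have "parcs G \<inter> T \<times> T = {(u, v). u \<in> T \<and> v \<in> T \<and> u \<noteq> v}"
      using T ne e arcs_symmetric[of x y] arcs_symmetric[of y z] arcs_symmetric[of x z] no_loops'
      by auto
    ultimately show "T \<in> triangles G" using K3 by (simp add: triangles_def)
  qed
qed

section \<open>Linear systems of triples without trilaterals, and their graphs\<close>

text \<open>The last assumption says that the union of the complete graphs on the blocks has no triangles
  other than the blocks.\<close>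

locale triangle_system =
  fixes V :: "'v set" and T :: "'v \<Rightarrow> 'p set"
  assumes finite_index: "finite V"
    and card_block: "v \<in> V \<Longrightarrow> card (T v) = 3"
    and meet_unique: "\<lbrakk>u \<in> V; v \<in> V; u \<noteq> v; x \<in> T u \<inter> T v; y \<in> T u \<inter> T v\<rbrakk> \<Longrightarrow> x = y"
    and no_trilateral: "\<lbrakk>u \<in> V; v \<in> V; w \<in> V; x \<in> T w \<inter> T u; y \<in> T u \<inter> T v; z \<in> T v \<inter> T w;
       x \<noteq> y; y \<noteq> z; x \<noteq> z\<rbrakk> \<Longrightarrow> u = v"
begin

lemma finite_block: "v \<in> V \<Longrightarrow> finite (T v)"
  using card_block by (metis card.infinite zero_neq_numeral)

lemma inj_on_block: "inj_on T V"
proof (rule inj_onI, rule ccontr)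
  fix u v assume A: "u \<in> V" "v \<in> V" "T u = T v" "u \<noteq> v"
  obtain x y where "x \<in> T u" "y \<in> T u" "x \<noteq> y"
    using card_block[OF A(1)] by (auto simp: card_3_iff)
  then show False using meet_unique[of u v x y] A by simp
qed

text \<open>Helly property. If \<open>y\<close> were not on \<open>T w\<close>, the three meeting
  points would be pairwise distinct: a point common to all three blocks would be \<open>y\<close> by
  \<open>meet_unique\<close>. That is a trilateral, so \<open>u = v\<close>.\<close>

lemma common_point:
  assumes V: "u \<in> V" "v \<in> V" "w \<in> V" "u \<noteq> v"
    and y: "y \<in> T u \<inter> T v" and meets: "T u \<inter> T w \<noteq> {}" "T v \<inter> T w \<noteq> {}"
  shows "y \<in> T w"
proof -
  obtain a b where "a \<in> T v \<inter> T w" "b \<in> T w \<inter> T u" using meets by blast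
  then show ?thesis using no_trilateral[of u v w b y a] meet_unique[of u v a y] V y by blast
qed

end

lemma card_3_third:
  assumes "card A = 3" "x \<in> A" "y \<in> A" "x \<noteq> y"
  shows "\<exists>z. A = {x, y, z} \<and> z \<noteq> x \<and> z \<noteq> y"
proof -
  have "card (A - {x, y}) = 1" using assms by (simp add: card_Diff_subset)
  then obtain z where "A - {x, y} = {z}" by (auto simp: card_1_singleton_iff)
  then show ?thesis using assms(2,3) by blast
qed

text \<open>This is the collinearity graph of the triple system.\<close>

definition system_graph :: "'v set \<Rightarrow> ('v \<Rightarrow> 'p set) \<Rightarrow> 'p pair_pre_digraph" where
  "system_graph V T =
     \<lparr>pverts = \<Union>(T ` V), parcs = {(x, y). x \<noteq> y \<and> (\<exists>v \<in> V. x \<in> T v \<and> y \<in> T v)}\<rparr>"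

context triangle_system
begin

lemma third_point:
  assumes "v \<in> V" "x \<in> T v" "y \<in> T v" "x \<noteq> y"
  obtains z where "T v = {x, y, z}" "z \<noteq> x" "z \<noteq> y"
  using card_3_third[OF card_block] assms by metis

lemma pair_graph_system_graph: "pair_graph (system_graph V T)"
  using finite_index finite_block
  by (auto simp: pair_graph_iff system_graph_def sym_def irrefl_def)

text \<open>A block through \<open>y\<close> and \<open>z\<close> and a block through
  \<open>x\<close> and \<open>z\<close> form a trilateral with \<open>T u\<close>, so the former is
  \<open>T u\<close> itself.\<close>

lemma common_neighbour_in_block:
  assumes "u \<in> V" "x \<in> T u" "y \<in> T u" "x \<noteq> y"
    and "(x, z) \<in> parcs (system_graph V T)" "(y, z) \<in> parcs (system_graph V T)"
  shows "z \<in> T u"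
proof -
  obtain v w where "v \<in> V" "w \<in> V" "x \<in> T w" "z \<in> T w" "y \<in> T v" "z \<in> T v" "x \<noteq> z" "y \<noteq> z"
    using assms by (auto simp: system_graph_def)
  then show ?thesis using no_trilateral[of u v w x y z] assms by blast
qed

text \<open>A triangle has an edge in some block, and its third corner falls into the same block by
  \<open>common_neighbour_in_block\<close>.\<close>

lemma triangles_system_graph: "triangles (system_graph V T) = T ` V"
proof -
  let ?E = "parcs (system_graph V T)"
  have "T v \<in> {{x, y, z} |x y z. (x, y) \<in> ?E \<and> (y, z) \<in> ?E \<and> (x, z) \<in> ?E}" if v: "v \<in> V" for v
  proof -
    obtain x y z where "T v = {x, y, z}" "x \<noteq> y" "y \<noteq> z" "x \<noteq> z"
      using card_block[OF v] by (auto simp: card_3_iff)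
    moreover from this have "(x, y) \<in> ?E" "(y, z) \<in> ?E" "(x, z) \<in> ?E"
      using v by (auto simp: system_graph_def intro!: bexI[of _ v])
    ultimately show ?thesis by blast
  qed
  moreover have "{x, y, z} \<in> T ` V" if e: "(x, y) \<in> ?E" "(y, z) \<in> ?E" "(x, z) \<in> ?E" for x y z
  proof -
    obtain u where u: "u \<in> V" "x \<in> T u" "y \<in> T u" "x \<noteq> y"
      using e by (auto simp: system_graph_def)
    have "z \<in> T u" by (rule common_neighbour_in_block[OF u e(3,2)])
    moreover have "z \<noteq> x" "z \<noteq> y" using e by (auto simp: system_graph_def)
    ultimately have "T u = {x, y, z}" using third_point[OF u] by (metis insertE singletonD)
    then show ?thesis using u by blast
  qed
  ultimately show ?thesis
    unfolding triangles_eq[OF pair_graph_system_graph] by blast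
qed

text \<open>The only common neighbour of two points of a block is the third point of that
  block.\<close>

lemma locally_linear_system_graph: "locally_linear (system_graph V T)"
proof -
  let ?E = "parcs (system_graph V T)"
  have "\<exists>w. (x, w) \<in> ?E" if x: "x \<in> pverts (system_graph V T)" for x
  proof -
    obtain v where v: "v \<in> V" "x \<in> T v" using x by (auto simp: system_graph_def)
    obtain y where "y \<in> T v" "y \<noteq> x"
      using card_block[OF v(1)] v(2) by (auto simp: card_3_iff)
    then show ?thesis using v by (auto simp: system_graph_def)
  qed
  moreover have "\<exists>!z. (x, z) \<in> ?E \<and> (y, z) \<in> ?E" if xy: "(x, y) \<in> ?E" for x y
  proof -
    obtain u where u: "u \<in> V" "x \<in> T u" "y \<in> T u" "x \<noteq> y"
      using xy by (auto simp: system_graph_def)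
    obtain z where z: "T u = {x, y, z}" "z \<noteq> x" "z \<noteq> y" using third_point[OF u] .
    show ?thesis
    proof (rule ex1I[of _ z])
      show "(x, z) \<in> ?E \<and> (y, z) \<in> ?E" using u z by (auto simp: system_graph_def)
      fix w assume w: "(x, w) \<in> ?E \<and> (y, w) \<in> ?E"
      then have "w \<in> T u" using common_neighbour_in_block[OF u] by blast
      moreover have "w \<noteq> x" "w \<noteq> y" using w by (auto simp: system_graph_def)
      ultimately show "w = z" using z by blast
    qed
  qed
  ultimately show ?thesis using pair_graph_system_graph by (auto simp: locally_linear_iff)
qed

text \<open>Allows the triangles of one graph to be indexed by those of another, so that two systems
  can be compared over one index set.\<close>

lemma reindex:
  assumes f: "bij_betw f U V"
  shows "triangle_system U (\<lambda>u. T (f u))" "system_graph U (\<lambda>u. T (f u)) = system_graph V T"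
proof -
  have inj: "inj_on f U" and img: "f ` U = V" using f by (auto simp: bij_betw_def)
  have mem: "u \<in> U \<Longrightarrow> f u \<in> V" for u using img by blast
  show "triangle_system U (\<lambda>u. T (f u))"
  proof
    show "finite U" using finite_index inj img finite_imageD by blast
  next
    fix u v x y assume "u \<in> U" "v \<in> U" "u \<noteq> v" "x \<in> T (f u) \<inter> T (f v)" "y \<in> T (f u) \<inter> T (f v)"
    then show "x = y" using meet_unique[of "f u" "f v"] mem inj_onD[OF inj] by blast
  next
    fix u v w x y z
    assume "u \<in> U" "v \<in> U" "w \<in> U" "x \<in> T (f w) \<inter> T (f u)" "y \<in> T (f u) \<inter> T (f v)"
      "z \<in> T (f v) \<inter> T (f w)" "x \<noteq> y" "y \<noteq> z" "x \<noteq> z"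
    then show "u = v" using no_trilateral[of "f u" "f v" "f w"] mem inj_onD[OF inj] by metis
  qed (simp add: card_block mem)
  show "system_graph U (\<lambda>u. T (f u)) = system_graph V T"
    by (simp add: system_graph_def img[symmetric] image_image)
qed

text \<open>Renames the points; this later moves the constructed system to the natural
  numbers.\<close>

lemma compose_inj:
  assumes inj: "inj_on g (\<Union>(T ` V))"
  shows "triangle_system V (\<lambda>v. g ` T v)"
proof -
  have eq: "g a = g b \<longleftrightarrow> a = b" if "u \<in> V" "v \<in> V" "a \<in> T u" "b \<in> T v" for u v a b
    using inj that by (meson UN_I inj_on_eq_iff)
  have int: "g ` T u \<inter> g ` T v = g ` (T u \<inter> T v)" if "u \<in> V" "v \<in> V" for u v
    using eq that by blast
  show ?thesis
  proof
    fix v assume "v \<in> V"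
    then have "inj_on g (T v)" using inj by (meson UN_upper inj_on_subset)
    then show "card (g ` T v) = 3" using card_block \<open>v \<in> V\<close> by (simp add: card_image)
  next
    fix u v x y assume "u \<in> V" "v \<in> V" "u \<noteq> v" "x \<in> g ` T u \<inter> g ` T v" "y \<in> g ` T u \<inter> g ` T v"
    then show "x = y" using meet_unique[of u v] int[of u v] by auto
  next
    fix u v w x y z
    assume m: "u \<in> V" "v \<in> V" "w \<in> V" "x \<in> g ` T w \<inter> g ` T u" "y \<in> g ` T u \<inter> g ` T v"
      "z \<in> g ` T v \<inter> g ` T w" "x \<noteq> y" "y \<noteq> z" "x \<noteq> z"
    from m obtain a b c where "a \<in> T w \<inter> T u" "b \<in> T u \<inter> T v" "c \<in> T v \<inter> T w"
      "x = g a" "y = g b" "z = g c"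
      using int[of w u] int[of u v] int[of v w] by auto
    moreover from this have "a \<noteq> b" "b \<noteq> c" "a \<noteq> c" using m by auto
    ultimately show "u = v" using m no_trilateral[of u v w a b c] by blast
  qed (rule finite_index)
qed

end

text \<open>Converse of \<open>locally_linear_system_graph\<close>: every locally linear graph is
  the graph of the system of its own triangles. Triangles with a common edge coincide because that
  edge has only one common neighbour.\<close>

lemma locally_linear_triangle_system:
  assumes "locally_linear G"
  shows "triangle_system (triangles G) (\<lambda>t. t)" "system_graph (triangles G) (\<lambda>t. t) = G"
proof -
  have pg: "pair_graph G" and iso: "\<And>v. v \<in> pverts G \<Longrightarrow> \<exists>w. (v, w) \<in> parcs G"
    and lin: "\<And>u v. (u, v) \<in> parcs G \<Longrightarrow> \<exists>!w. (u, w) \<in> parcs G \<and> (v, w) \<in> parcs G"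
    using assms by (auto simp: locally_linear_iff)
  interpret pair_graph G by (rule pg)
  note tri = triangles_eq[OF pg]
  have adj: "(x, y) \<in> parcs G" if "t \<in> triangles G" "x \<in> t" "y \<in> t" "x \<noteq> y" for t x y
    using that arcs_symmetric unfolding tri by auto
  have tI: "{x, y, z} \<in> triangles G"
    if "(x, y) \<in> parcs G" "(y, z) \<in> parcs G" "(x, z) \<in> parcs G" for x y z
    using that unfolding tri by blast
  have c3: "card t = 3" if "t \<in> triangles G" for t
    using that no_loops' unfolding tri by (auto simp: card_insert_if)
  have meet: "s = t" if st: "s \<in> triangles G" "t \<in> triangles G"
    and x: "x \<in> s" "x \<in> t" and y: "y \<in> s" "y \<in> t" and "x \<noteq> y" for s t x y
  proof -
    obtain z w where z: "s = {x, y, z}" "z \<noteq> x" "z \<noteq> y" and w: "t = {x, y, w}" "w \<noteq> x" "w \<noteq> y"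
      using card_3_third[OF c3 x(1) y(1)] card_3_third[OF c3 x(2) y(2)] st \<open>x \<noteq> y\<close> by blast
    have "(x, y) \<in> parcs G" using adj st(1) x(1) y(1) \<open>x \<noteq> y\<close> by blast
    moreover have "(x, z) \<in> parcs G" "(y, z) \<in> parcs G" using adj[OF st(1)] z by auto
    moreover have "(x, w) \<in> parcs G" "(y, w) \<in> parcs G" using adj[OF st(2)] w by auto
    ultimately have "z = w" using lin by blast
    then show ?thesis using z w by simp
  qed
  show "triangle_system (triangles G) (\<lambda>t. t)"
  proof
    have "triangles G \<subseteq> Pow (pverts G)" by (auto simp: triangles_def)
    then show "finite (triangles G)" using pair_finite_verts finite_subset by blast
  next
    fix u v w x y z
    assume V: "u \<in> triangles G" "v \<in> triangles G" "w \<in> triangles G"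
      and m: "x \<in> w \<inter> u" "y \<in> u \<inter> v" "z \<in> v \<inter> w" "x \<noteq> y" "y \<noteq> z" "x \<noteq> z"
    \<comment> \<open>The corners of a trilateral are pairwise adjacent, hence form a triangle,
      which shares two points with \<open>u\<close> and two with \<open>v\<close>.\<close>
    have t: "{x, y, z} \<in> triangles G" by (rule tI) (use adj V m in blast)+
    have "u = {x, y, z}" using meet[OF V(1) t, of x y] m by blast
    moreover have "v = {x, y, z}" using meet[OF V(2) t, of y z] m by blast
    ultimately show "u = v" by simp
  qed (use meet c3 in blast)+
  have edge: "\<exists>t \<in> triangles G. x \<in> t \<and> y \<in> t" if "(x, y) \<in> parcs G" for x y
    using lin[OF that] tI[OF that] by blast
  have "\<Union>(triangles G) \<subseteq> pverts G" by (auto simp: triangles_def)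
  moreover have "pverts G \<subseteq> \<Union>(triangles G)" using iso edge by blast
  ultimately have "\<Union>(triangles G) = pverts G" by simp
  moreover have "{(x, y). x \<noteq> y \<and> (\<exists>t \<in> triangles G. x \<in> t \<and> y \<in> t)} = parcs G"
    using adj edge no_loops' by blast
  ultimately show "system_graph (triangles G) (\<lambda>t. t) = G"
    by (simp add: system_graph_def)
qed

section \<open>Reconstruction of a system from its intersection pattern\<close>

text \<open>Glues bijections between fibres with the same label; the labels will be pencils.\<close>

lemma bij_betw_fibres:
  assumes "\<And>a. \<exists>h. bij_betw h {x \<in> X. p x = a} {y \<in> Y. q y = a}"
  obtains f where "bij_betw f X Y" "\<And>x. x \<in> X \<Longrightarrow> q (f x) = p x"
proof -
  obtain h where h: "bij_betw (h a) {x \<in> X. p x = a} {y \<in> Y. q y = a}" for a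
    using assms by metis
  let ?f = "\<lambda>x. h (p x) x"
  have f: "?f x \<in> Y \<and> q (?f x) = p x" if "x \<in> X" for x
    using bij_betwE[OF h[of "p x"]] that by simp
  have "bij_betw ?f X Y"
  proof (rule bij_betwI')
    fix x y assume xy: "x \<in> X" "y \<in> X"
    show "?f x = ?f y \<longleftrightarrow> x = y"
    proof
      assume eq: "?f x = ?f y"
      then have p: "p x = p y" using f xy by metis
      then show "x = y"
        using eq xy inj_onD[OF bij_betw_imp_inj_on[OF h[of "p x"]], of x y] by simp
    qed simp
  next
    fix y assume "y \<in> Y"
    then have "y \<in> h (q y) ` {x \<in> X. p x = q y}"
      using bij_betw_imp_surj_on[OF h[of "q y"]] by simp
    then obtain x where "x \<in> X" "p x = q y" "y = h (q y) x" by blast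
    then show "\<exists>x\<in>X. y = ?f x" by metis
  qed (use f in simp)
  then show thesis using f that by blast
qed

context triangle_system
begin

definition pencil :: "'p \<Rightarrow> 'v set" where
  "pencil x = {v \<in> V. x \<in> T v}"

definition points_on :: "'v set \<Rightarrow> 'p set" where
  "points_on A = {x \<in> \<Union>(T ` V). pencil x = A}"

lemma finite_points_on: "finite (points_on A)"
  unfolding points_on_def using finite_index finite_block by simp

lemma points_on_outside: "A = {} \<or> \<not> A \<subseteq> V \<Longrightarrow> points_on A = {}"
  by (auto simp: points_on_def pencil_def)

text \<open>Two blocks determine their common point, so a pencil with at least two members has at
  most one point. The count is thus a function of emptiness alone, which can be compared between
  systems.\<close>

lemma card_points_on_eq:
  assumes "u \<in> A" "v \<in> A" "u \<noteq> v"
  shows "card (points_on A) = (if points_on A = {} then 0 else 1)"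
proof -
  have eq: "x = y" if xy: "x \<in> points_on A" "y \<in> points_on A" for x y
  proof (rule meet_unique[of u v])
    show "u \<in> V" "v \<in> V" "u \<noteq> v" "x \<in> T u \<inter> T v" "y \<in> T u \<inter> T v"
      using xy assms by (auto simp: points_on_def pencil_def)
  qed
  show ?thesis
  proof (cases "points_on A = {}")
    case False
    then obtain x where "x \<in> points_on A" by blast
    then have "points_on A = {x}" using eq by blast
    then show ?thesis by simp
  qed simp
qed

text \<open>The three points of \<open>T v\<close> are partitioned according to their pencils, all
  of which contain \<open>v\<close>.\<close>

lemma sum_card_points_on:
  assumes "v \<in> V"
  shows "(\<Sum>A \<in> {A \<in> Pow V. v \<in> A}. card (points_on A)) = 3"
proof -
  have "T v = (\<Union>A \<in> {A \<in> Pow V. v \<in> A}. points_on A)"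
  proof (intro subset_antisym subsetI)
    fix x assume "x \<in> T v"
    then have "x \<in> points_on (pencil x)" "pencil x \<in> {A \<in> Pow V. v \<in> A}"
      using assms by (auto simp: points_on_def pencil_def)
    then show "x \<in> (\<Union>A \<in> {A \<in> Pow V. v \<in> A}. points_on A)" by blast
  next
    fix x assume "x \<in> (\<Union>A \<in> {A \<in> Pow V. v \<in> A}. points_on A)"
    then have "v \<in> pencil x" by (auto simp: points_on_def)
    then show "x \<in> T v" by (simp add: pencil_def)
  qed
  then have "3 = card (\<Union>A \<in> {A \<in> Pow V. v \<in> A}. points_on A)"
    using card_block[OF assms] by simp
  also have "\<dots> = (\<Sum>A \<in> {A \<in> Pow V. v \<in> A}. card (points_on A))"
    by (rule card_UN_disjoint) (auto simp: finite_index finite_points_on, auto simp: points_on_def)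
  finally show ?thesis by simp
qed

text \<open>Expresses the number of private points of \<open>v\<close> by the larger pencils. The
  truncated subtraction is exact, as the sum is part of a total of 3.\<close>

lemma card_points_on_singleton:
  assumes "v \<in> V"
  shows "card (points_on {v}) = 3 - (\<Sum>A \<in> {A \<in> Pow V. v \<in> A} - {{v}}. card (points_on A))"
  using sum_card_points_on[OF assms] assms finite_index
  by (subst (asm) sum.remove[of _ "{v}"]) auto

end

text \<open>Models an isomorphism of triangle graphs: \<open>S v\<close> and \<open>T v\<close> are
  corresponding triangles, while the points are not yet matched.\<close>

locale same_intersections = S: triangle_system V S + T: triangle_system V T
  for V :: "'v set" and S :: "'v \<Rightarrow> 'p set" and T :: "'v \<Rightarrow> 'q set" +
  assumes meets_iff: "\<lbrakk>u \<in> V; v \<in> V; u \<noteq> v\<rbrakk> \<Longrightarrow> S u \<inter> S v = {} \<longleftrightarrow> T u \<inter> T v = {}"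
begin

lemma swap: "same_intersections V T S"
  by unfold_locales (simp add: meets_iff)

text \<open>A further block \<open>S w\<close> through \<open>x\<close> meets \<open>S u\<close> and
  \<open>S v\<close>; hence \<open>T w\<close> meets \<open>T u\<close> and \<open>T v\<close>, and
  the Helly property puts \<open>y\<close> on it.\<close>

lemma pencil_subset:
  assumes "u \<in> V" "v \<in> V" "u \<noteq> v" "x \<in> S u \<inter> S v" "y \<in> T u \<inter> T v"
  shows "S.pencil x \<subseteq> T.pencil y"
proof
  fix w assume "w \<in> S.pencil x"
  then have w: "w \<in> V" "x \<in> S w" by (auto simp: S.pencil_def)
  show "w \<in> T.pencil y"
  proof (cases "w = u \<or> w = v")
    case False
    then have "T u \<inter> T w \<noteq> {}" "T v \<inter> T w \<noteq> {}"
      using meets_iff[of u w] meets_iff[of v w] assms w by auto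
    then have "y \<in> T w" using T.common_point[of u v w y] assms w by blast
    then show ?thesis using w by (simp add: T.pencil_def)
  qed (use assms in \<open>auto simp: T.pencil_def\<close>)
qed

text \<open>If \<open>A\<close> is the pencil of \<open>x\<close>, then \<open>T u\<close> and
  \<open>T v\<close> meet in some \<open>y\<close>, and \<open>pencil_subset\<close> in both
  directions shows that \<open>A\<close> is also the pencil of \<open>y\<close>.\<close>

lemma points_on_nonempty:
  assumes A: "u \<in> A" "v \<in> A" "u \<noteq> v" and "S.points_on A \<noteq> {}"
  shows "T.points_on A \<noteq> {}"
proof -
  interpret swap: same_intersections V T S by (rule swap)
  obtain x where x: "A = S.pencil x" using assms by (auto simp: S.points_on_def)
  then have uv: "u \<in> V" "v \<in> V" "x \<in> S u \<inter> S v" using A by (auto simp: S.pencil_def)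
  then obtain y where y: "y \<in> T u \<inter> T v" using meets_iff A by blast
  then have "S.pencil x = T.pencil y"
    using pencil_subset[of u v x y] swap.pencil_subset[of u v y x] uv A by blast
  then show ?thesis using x y uv by (auto simp: T.points_on_def)
qed

lemma card_points_on: "card (S.points_on A) = card (T.points_on A)"
proof -
  interpret swap: same_intersections V T S by (rule swap)
  have two: "card (S.points_on A) = card (T.points_on A)"
    if "u \<in> A" "v \<in> A" "u \<noteq> v" for A u v
    using S.card_points_on_eq[OF that] T.card_points_on_eq[OF that]
      points_on_nonempty[OF that] swap.points_on_nonempty[OF that] by auto
  consider "A = {} \<or> \<not> A \<subseteq> V" | v where "A = {v}" "v \<in> V" | u v where "u \<in> A" "v \<in> A" "u \<noteq> v"
    by blast
  then show ?thesis
  proof cases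
    \<comment> \<open>Every other pencil containing \<open>v\<close> has a second member, so
      \<open>two\<close> applies to each summand, and the complements to 3 agree.\<close>
    case (2 v)
    have "(\<Sum>B \<in> {B \<in> Pow V. v \<in> B} - {{v}}. card (S.points_on B)) =
        (\<Sum>B \<in> {B \<in> Pow V. v \<in> B} - {{v}}. card (T.points_on B))"
    proof (rule sum.cong)
      fix B assume "B \<in> {B \<in> Pow V. v \<in> B} - {{v}}"
      then obtain u where "u \<in> B" "v \<in> B" "u \<noteq> v" by blast
      then show "card (S.points_on B) = card (T.points_on B)" by (rule two)
    qed simp
    then show ?thesis
      unfolding 2(1) S.card_points_on_singleton[OF 2(2)] T.card_points_on_singleton[OF 2(2)] by simp
  qed (auto simp: S.points_on_outside T.points_on_outside two)
qed

lemma system_graph_iso: "digraph_iso (with_proj (system_graph V S)) (with_proj (system_graph V T))"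
proof -
  have "\<exists>h. bij_betw h {x \<in> \<Union>(S ` V). S.pencil x = A} {y \<in> \<Union>(T ` V). T.pencil y = A}" for A
    using card_points_on[of A] S.finite_points_on[of A] T.finite_points_on[of A]
    unfolding S.points_on_def[symmetric] T.points_on_def[symmetric]
    by (rule finite_same_card_bij[rotated 2])
  then obtain f where f: "bij_betw f (\<Union>(S ` V)) (\<Union>(T ` V))"
    and pen: "\<And>x. x \<in> \<Union>(S ` V) \<Longrightarrow> T.pencil (f x) = S.pencil x"
    by (rule bij_betw_fibres) blast
  \<comment> \<open>Incidence is membership in a pencil, so a pencil-preserving map respects the
    blocks.\<close>
  have mem: "f x \<in> T v \<longleftrightarrow> x \<in> S v" if "v \<in> V" "x \<in> \<Union>(S ` V)" for v x
    using pen[OF that(2)] that by (auto simp: S.pencil_def T.pencil_def)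
  have ne: "f x = f y \<longleftrightarrow> x = y" if "x \<in> \<Union>(S ` V)" "y \<in> \<Union>(S ` V)" for x y
    using f that by (meson bij_betw_imp_inj_on inj_on_eq_iff)
  interpret GS: pair_graph "system_graph V S" by (rule S.pair_graph_system_graph)
  interpret GT: pair_graph "system_graph V T" by (rule T.pair_graph_system_graph)
  show ?thesis
  proof (rule digraph_iso_pairI)
    show "bij_betw f (pverts (system_graph V S)) (pverts (system_graph V T))"
      using f by (simp add: system_graph_def)
    fix x y assume "x \<in> pverts (system_graph V S)" "y \<in> pverts (system_graph V S)"
    then have xy: "x \<in> \<Union>(S ` V)" "y \<in> \<Union>(S ` V)" by (simp_all add: system_graph_def)
    have "(\<exists>v\<in>V. f x \<in> T v \<and> f y \<in> T v) \<longleftrightarrow> (\<exists>v\<in>V. x \<in> S v \<and> y \<in> S v)"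
      using mem xy by blast
    then show "(x, y) \<in> parcs (system_graph V S) \<longleftrightarrow> (f x, f y) \<in> parcs (system_graph V T)"
      using ne[OF xy] by (simp add: system_graph_def)
  qed unfold_locales
qed

end

text \<open>Both graphs are graphs of their triangle systems. Reindexing the second along the given
  isomorphism yields two systems with the same intersections.\<close>

lemma locally_linear_iso_of_triangle_graph_iso:
  assumes G: "locally_linear G" and G': "locally_linear G'"
    and iso: "digraph_iso (with_proj (triangle_graph G)) (with_proj (triangle_graph G'))"
  shows "digraph_iso (with_proj G) (with_proj G')"
proof -
  obtain f where f: "bij_betw f (triangles G) (triangles G')"
    and arcs: "\<And>s t. s \<in> triangles G \<Longrightarrow> t \<in> triangles G \<Longrightarrow>
      (s, t) \<in> parcs (triangle_graph G) \<longleftrightarrow> (f s, f t) \<in> parcs (triangle_graph G')"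
    using digraph_iso_pairE[OF iso] by (auto simp: triangle_graph_def)
  interpret S: triangle_system "triangles G" "\<lambda>t. t"
    using G by (rule locally_linear_triangle_system)
  interpret T': triangle_system "triangles G'" "\<lambda>t. t"
    using G' by (rule locally_linear_triangle_system)
  interpret T: triangle_system "triangles G" f
    using T'.reindex(1)[OF f] .
  have ne: "f s \<noteq> f t" if "s \<in> triangles G" "t \<in> triangles G" "s \<noteq> t" for s t
    using f that by (meson bij_betw_imp_inj_on inj_onD)
  have mem: "f s \<in> triangles G'" if "s \<in> triangles G" for s
    using f that by (meson bij_betwE)
  interpret same_intersections "triangles G" "\<lambda>t. t" f
  proof unfold_locales
    fix s t assume st: "s \<in> triangles G" "t \<in> triangles G" "s \<noteq> t"
    show "s \<inter> t = {} \<longleftrightarrow> f s \<inter> f t = {}"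
      using arcs[OF st(1,2)] st ne[OF st] mem by (simp add: triangle_graph_def)
  qed
  show ?thesis
    using system_graph_iso T'.reindex(2)[OF f]
    by (simp add: locally_linear_triangle_system(2) G G')
qed

section \<open>Lines of a graph without induced K_4 - e and K_{1,4}\<close>

lemma induced_subgraph_pairI:
  assumes "pair_wf_digraph H" "W \<subseteq> pverts H"
  shows "induced_subgraph (with_proj \<lparr>pverts = W, parcs = parcs H \<inter> W \<times> W\<rparr>) (with_proj H)"
proof -
  interpret pair_wf_digraph H by fact
  have "pair_wf_digraph \<lparr>pverts = W, parcs = parcs H \<inter> W \<times> W\<rparr>" by unfold_locales auto
  then have "wf_digraph (with_proj \<lparr>pverts = W, parcs = parcs H \<inter> W \<times> W\<rparr>)"
    by (simp add: wf_digraph_wp_iff)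
  then show ?thesis using assms wf_digraph
    by (auto simp: induced_subgraph_def subgraph_def compatible_def)
qed

locale K4e_K14_free = pair_graph H for H :: "'a pair_pre_digraph" +
  assumes K4e_free: "\<nexists>D :: 'a pair_pre_digraph. induced_subgraph (with_proj D) (with_proj H) \<and> K4_minus_edge D"
    and K14_free: "\<nexists>D :: 'a pair_pre_digraph. induced_subgraph (with_proj D) (with_proj H) \<and> K\<^bsub>1,4\<^esub> (with_proj D)"
begin

lemma wf_H: "pair_wf_digraph H"
  by unfold_locales

text \<open>Otherwise the four vertices induce K_4 with the edge \<open>wx\<close> deleted.\<close>

lemma common_neighbours_adjacent:
  assumes uv: "(u, v) \<in> parcs H" and w: "(u, w) \<in> parcs H" "(v, w) \<in> parcs H"
    and x: "(u, x) \<in> parcs H" "(v, x) \<in> parcs H" and "w \<noteq> x"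
  shows "(w, x) \<in> parcs H"
proof (rule ccontr)
  assume wx: "(w, x) \<notin> parcs H"
  let ?W = "{u, v, w, x}"
  let ?K = "\<lparr>pverts = ?W, parcs = {(a, b). (a, b) \<in> ?W \<times> ?W \<and> a \<noteq> b}\<rparr>"
  let ?D = "\<lparr>pverts = ?W, parcs = parcs H \<inter> ?W \<times> ?W\<rparr>"
  have ne: "u \<noteq> v" "u \<noteq> w" "v \<noteq> w" "u \<noteq> x" "v \<noteq> x"
    using assms no_loops' by blast+
  have "K\<^bsub>4\<^esub> (with_proj ?K)"
    unfolding complete_digraph_pair_def using ne \<open>w \<noteq> x\<close> by simp
  moreover have "(w, x) \<in> parcs ?K" using \<open>w \<noteq> x\<close> by simp
  moreover have "?D = ?K\<lparr>parcs := parcs ?K - {(w, x), (x, w)}\<rparr>"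
  proof -
    have sym: "(b, a) \<in> parcs H \<longleftrightarrow> (a, b) \<in> parcs H" for a b
      using arcs_symmetric by blast
    have "(a, a) \<notin> parcs H" for a using no_loops' by blast
    then have "parcs H \<inter> ?W \<times> ?W = parcs ?K - {(w, x), (x, w)}"
      using ne wx uv w x sym[of u v] sym[of u w] sym[of v w] sym[of u x] sym[of v x] sym[of w x]
        \<open>w \<noteq> x\<close>
      by auto
    then show ?thesis by simp
  qed
  ultimately have "K4_minus_edge ?D" unfolding K4_minus_edge_def by blast
  moreover have "?W \<subseteq> pverts H" using uv w x wellformed' by blast
  ultimately show False using K4e_free induced_subgraph_pairI[OF wf_H] by blast
qed

text \<open>Four independent neighbours together with \<open>v\<close> induce K_{1,4}.\<close>

lemma independent_neighbours_card:
  assumes X: "X \<subseteq> {w. (v, w) \<in> parcs H}" and indep: "\<And>x y. x \<in> X \<Longrightarrow> y \<in> X \<Longrightarrow> (x, y) \<notin> parcs H"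
  shows "card X \<le> 3"
proof (rule ccontr)
  assume "\<not> card X \<le> 3"
  then obtain Y where Y: "Y \<subseteq> X" "card Y = 4"
    using obtain_subset_with_card_n[of 4 X] by auto
  let ?W = "insert v Y"
  let ?D = "\<lparr>pverts = ?W, parcs = parcs H \<inter> ?W \<times> ?W\<rparr>"
  have "finite Y" using Y(2) by (metis card.infinite zero_neq_numeral)
  have irr: "(a, a) \<notin> parcs H" for a using no_loops' by blast
  have vY: "(v, y) \<in> parcs H" "(y, v) \<in> parcs H" if "y \<in> Y" for y
    using that Y X arcs_symmetric by blast+
  have "parcs H \<inter> ?W \<times> ?W = {v} \<times> Y \<union> Y \<times> {v}"
    using vY irr indep Y(1) by blast
  moreover have "?W = {v} \<union> Y" "{v} \<inter> Y = {}" using vY irr by blast+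
  moreover have "card {v} = 1" by simp
  ultimately have "\<exists>A B. pverts ?D = A \<union> B \<and> A \<inter> B = {} \<and> card A = 1 \<and> card B = 4 \<and>
      parcs ?D = A \<times> B \<union> B \<times> A"
    unfolding pair_pre_digraph.simps using Y(2) by blast
  then have "K\<^bsub>1,4\<^esub> (with_proj ?D)"
    using \<open>finite Y\<close> by (simp add: complete_bipartite_digraph_pair_def)
  moreover have "?W \<subseteq> pverts H"
  proof -
    obtain y where "y \<in> Y" using Y(2) by fastforce
    then show ?thesis using vY wellformed' by blast
  qed
  ultimately show False using K14_free induced_subgraph_pairI[OF wf_H] by blast
qed

text \<open>For an edge \<open>uv\<close> this is the unique maximal clique containing it.\<close>

definition line :: "'a \<Rightarrow> 'a \<Rightarrow> 'a set" where
  "line u v = {u, v} \<union> {w. (u, w) \<in> parcs H \<and> (v, w) \<in> parcs H}"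

definition lines :: "'a set set" where
  "lines = {line u v |u v. (u, v) \<in> parcs H}"

definition lines_at :: "'a \<Rightarrow> 'a set set" where
  "lines_at v = {l \<in> lines. v \<in> l}"

lemma line_adjacent:
  assumes uv: "(u, v) \<in> parcs H" and x: "x \<in> line u v" "y \<in> line u v" "x \<noteq> y"
  shows "(x, y) \<in> parcs H"
  using assms arcs_symmetric common_neighbours_adjacent[OF uv]
  unfolding line_def by blast

text \<open>A line is a clique, so each of its points is \<open>x\<close>, \<open>y\<close> or
  adjacent to both; this is one inclusion. Then \<open>u\<close> and \<open>v\<close> lie on
  \<open>line x y\<close>, and the roles can be exchanged.\<close>

lemma line_eq:
  assumes uv: "(u, v) \<in> parcs H" and x: "x \<in> line u v" "y \<in> line u v" "x \<noteq> y"
  shows "line u v = line x y"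
proof -
  have sub: "line u v \<subseteq> line x y"
    if "(u, v) \<in> parcs H" "x \<in> line u v" "y \<in> line u v" "x \<noteq> y" for u v x y
  proof
    fix w assume "w \<in> line u v"
    then show "w \<in> line x y"
      using line_adjacent[OF that(1)] that(2-4) unfolding line_def[of x y] by blast
  qed
  have xy: "(x, y) \<in> parcs H" using line_adjacent assms .
  have "u \<in> line u v" "v \<in> line u v" "u \<noteq> v" using uv no_loops' by (auto simp: line_def)
  then have "u \<in> line x y" "v \<in> line x y" "u \<noteq> v" using sub[OF assms] by auto
  then show ?thesis using sub[OF assms] sub[OF xy] by blast
qed

lemma lines_eq:
  assumes "l \<in> lines" "x \<in> l" "y \<in> l" "x \<noteq> y"
  shows "l = line x y" "(x, y) \<in> parcs H"
proof -
  obtain u v where uv: "(u, v) \<in> parcs H" and l: "l = line u v"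
    using assms(1) by (auto simp: lines_def)
  show "l = line x y" "(x, y) \<in> parcs H"
    using line_eq[OF uv] line_adjacent[OF uv] assms(2-4) unfolding l by blast+
qed

lemma lines_subset: "l \<in> lines \<Longrightarrow> l \<subseteq> pverts H"
  using wellformed' by (auto simp: lines_def line_def)

lemma finite_lines: "finite lines"
  using lines_subset pair_finite_verts by (meson Pow_iff finite_Pow_iff finite_subset subsetI)

lemma line_other_point:
  assumes "l \<in> lines" "v \<in> l"
  shows "\<exists>w. w \<in> l \<and> w \<noteq> v"
proof -
  obtain u w where uw: "(u, w) \<in> parcs H" and l: "l = line u w"
    using assms(1) by (auto simp: lines_def)
  then have "u \<in> l" "w \<in> l" "u \<noteq> w" using no_loops' by (auto simp: line_def)
  then show ?thesis by metis
qed

text \<open>One further point \<open>p l\<close> is chosen on each line \<open>l\<close> through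
  \<open>v\<close>. These are distinct, pairwise non-adjacent neighbours of \<open>v\<close>, so
  there are at most three.\<close>

lemma card_lines_at: "card (lines_at v) \<le> 3"
proof -
  have "\<forall>l \<in> lines_at v. \<exists>w. w \<in> l \<and> w \<noteq> v"
    using line_other_point by (simp add: lines_at_def)
  then obtain p where p: "\<And>l. l \<in> lines_at v \<Longrightarrow> p l \<in> l \<and> p l \<noteq> v"
    by metis
  have line: "l = line v (p l)" "(v, p l) \<in> parcs H" if "l \<in> lines_at v" for l
    using lines_eq[of l v "p l"] p[OF that] that by (auto simp: lines_at_def)
  have inj: "inj_on p (lines_at v)" using line by (metis inj_onI)
  have "card (p ` lines_at v) \<le> 3"
  proof (rule independent_neighbours_card)
    show "p ` lines_at v \<subseteq> {w. (v, w) \<in> parcs H}" using line by blast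
    fix x y assume "x \<in> p ` lines_at v" "y \<in> p ` lines_at v"
    then obtain k l where kl: "k \<in> lines_at v" "l \<in> lines_at v" "x = p k" "y = p l" by blast
    show "(x, y) \<notin> parcs H"
    proof
      assume xy: "(x, y) \<in> parcs H"
      then have "x \<noteq> y" using no_loops' by blast
      have "(v, x) \<in> parcs H" "(v, y) \<in> parcs H" using line kl by blast+
      \<comment> \<open>Adjacency of \<open>x\<close> and \<open>y\<close> would put
        \<open>y\<close> on \<open>k\<close>, the line through \<open>v\<close> and
        \<open>x\<close>, so that \<open>k\<close> and \<open>l\<close> share \<open>v\<close> and
        \<open>y\<close> and coincide.\<close>
      then have "y \<in> line v x" using xy arcs_symmetric by (simp add: line_def)
      moreover have "k = line v x" using line(1)[OF kl(1)] kl(3) by simp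
      ultimately have "k = line v y"
        using lines_eq(1)[of k v y] kl p by (metis (mono_tags, lifting) lines_at_def mem_Collect_eq)
      moreover have "l = line v y" using line(1)[OF kl(2)] kl(4) by simp
      ultimately have "k = l" by (rule trans[OF _ sym])
      then show False using kl(3,4) \<open>x \<noteq> y\<close> by blast
    qed
  qed
  then show ?thesis using card_image[OF inj] by simp
qed

section \<open>Construction of a system with prescribed intersection graph\<close>

text \<open>Shared points are lines, tagged \<open>Inl\<close>. The padding points carry the vertex
  \<open>v\<close>, so they belong to no other block.\<close>

definition block :: "'a \<Rightarrow> ('a set + 'a \<times> nat) set" where
  "block v = Inl ` lines_at v \<union> Inr ` ({v} \<times> {..<3 - card (lines_at v)})"

lemma card_block: "card (block v) = 3"
proof -
  have "finite (lines_at v)" using finite_lines by (simp add: lines_at_def)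
  then have "card (block v) = card (lines_at v) + (3 - card (lines_at v))"
    unfolding block_def
    by (subst card_Un_disjoint) (auto simp: card_image card_cartesian_product)
  then show ?thesis using card_lines_at[of v] by simp
qed

text \<open>Only lines can be shared, and two distinct vertices lie on a common line exactly if they
  are adjacent, in which case \<open>lines_eq\<close> identifies it.\<close>

lemma block_Int:
  assumes "u \<noteq> v"
  shows "block u \<inter> block v = (if (u, v) \<in> parcs H then {Inl (line u v)} else {})"
proof -
  have "block u \<inter> block v = Inl ` (lines_at u \<inter> lines_at v)"
    using assms by (auto simp: block_def)
  also have "lines_at u \<inter> lines_at v = (if (u, v) \<in> parcs H then {line u v} else {})"
  proof -
    have "l = line u v \<and> (u, v) \<in> parcs H" if "l \<in> lines_at u \<inter> lines_at v" for l
      using lines_eq[of l u v] that assms by (auto simp: lines_at_def)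
    moreover have "line u v \<in> lines_at u \<inter> lines_at v" if "(u, v) \<in> parcs H"
      using that by (auto simp: lines_at_def lines_def line_def)
    ultimately show ?thesis by auto
  qed
  finally show ?thesis by auto
qed

lemma block_meet_unique:
  assumes "u \<noteq> v" "x \<in> block u \<inter> block v" "y \<in> block u \<inter> block v"
  shows "x = y"
  using assms(2,3) unfolding block_Int[OF assms(1)] by (auto split: if_splits)

lemma triangle_system_block: "triangle_system (pverts H) block"
proof
  fix u v w x y z
  assume m: "x \<in> block w \<inter> block u" "y \<in> block u \<inter> block v" "z \<in> block v \<inter> block w"
    "x \<noteq> y" "y \<noteq> z" "x \<noteq> z"
  show "u = v"
  proof (rule ccontr)
    assume uv: "u \<noteq> v"
    then have y: "y = Inl (line u v)" "(u, v) \<in> parcs H"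
      using m(2) by (auto simp: block_Int split: if_splits)
    show False
    \<comment> \<open>If \<open>w\<close> is \<open>u\<close> or \<open>v\<close>, two of the three
      points lie in both \<open>block u\<close> and \<open>block v\<close> and are equal.\<close>
    proof (cases "w = u \<or> w = v")
      case True
      then show False using block_meet_unique[OF uv] m by blast
    next
      case False
      then have wu: "x = Inl (line w u)" "(w, u) \<in> parcs H"
        and vw: "z = Inl (line v w)" "(v, w) \<in> parcs H"
        using m block_Int[of w u] block_Int[of v w] by (auto split: if_splits)
      \<comment> \<open>Now \<open>w\<close> is a common neighbour of \<open>u\<close> and
        \<open>v\<close>, so \<open>line u v\<close> is also \<open>line v w\<close>, giving
        \<open>y = z\<close>.\<close>
      have "w \<in> line u v" using wu vw arcs_symmetric by (auto simp: line_def)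
      moreover have "v \<in> line u v" by (simp add: line_def)
      ultimately have "line u v = line v w" using line_eq[OF y(2)] False by metis
      then show False using y vw m by simp
    qed
  qed
next
  fix u v x y assume "u \<noteq> v" "x \<in> block u \<inter> block v" "y \<in> block u \<inter> block v"
  then show "x = y" by (rule block_meet_unique)
qed (simp_all add: card_block pair_finite_verts)

lemma ex_locally_linear:
  "\<exists>G :: nat pair_pre_digraph. locally_linear G \<and> digraph_iso (with_proj (triangle_graph G)) (with_proj H)"
proof -
  interpret B: triangle_system "pverts H" block by (rule triangle_system_block)
  have "finite (\<Union>(block ` pverts H))" using pair_finite_verts B.finite_block by blast
  then obtain g :: "_ \<Rightarrow> nat" where g: "inj_on g (\<Union>(block ` pverts H))"
    using finite_imp_inj_to_nat_seg by metis
  let ?T = "\<lambda>v. g ` block v"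
  interpret T: triangle_system "pverts H" ?T by (rule B.compose_inj[OF g])
  let ?G = "system_graph (pverts H) ?T"
  have wf: "pair_wf_digraph (triangle_graph ?G)"
    by unfold_locales (auto simp: triangle_graph_def)
  have "digraph_iso (with_proj H) (with_proj (triangle_graph ?G))"
  proof (rule digraph_iso_pairI[OF wf_H wf])
    show "bij_betw ?T (pverts H) (pverts (triangle_graph ?G))"
      using T.inj_on_block by (simp add: triangle_graph_def T.triangles_system_graph bij_betw_def)
    fix u v assume uv: "u \<in> pverts H" "v \<in> pverts H"
    have "?T u \<noteq> ?T v \<longleftrightarrow> u \<noteq> v" using inj_on_eq_iff[OF T.inj_on_block] uv by simp
    moreover have "?T u \<inter> ?T v = g ` (block u \<inter> block v)"
      \<comment> \<open>Injectivity of \<open>g\<close> on all points keeps disjoint blocks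
        disjoint.\<close>
      using inj_on_image_Int[OF g, of "block u" "block v"] uv by blast
    ultimately have "(?T u, ?T v) \<in> parcs (triangle_graph ?G) \<longleftrightarrow> u \<noteq> v \<and> block u \<inter> block v \<noteq> {}"
      using uv by (simp add: triangle_graph_def T.triangles_system_graph)
    also have "\<dots> \<longleftrightarrow> (u, v) \<in> parcs H"
      using no_loops' block_Int[of u v] by auto
    finally show "(u, v) \<in> parcs H \<longleftrightarrow> (?T u, ?T v) \<in> parcs (triangle_graph ?G)" ..
  qed
  then have "digraph_iso (with_proj (triangle_graph ?G)) (with_proj H)"
    by (rule digraph_iso_swap[OF wf_digraph])
  then show ?thesis using T.locally_linear_system_graph by blast
qed

end

text \<open>Existence is witnessed over \<open>nat\<close>, where any finite set of points embeds;
  uniqueness compares graphs over two arbitrary vertex types.\<close>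

theorem theorem2:
  fixes H :: "'a pair_pre_digraph"
  assumes "pair_graph H"
    and "\<nexists>D :: 'a pair_pre_digraph. induced_subgraph (with_proj D) (with_proj H) \<and> K4_minus_edge D"
    and "\<nexists>D :: 'a pair_pre_digraph. induced_subgraph (with_proj D) (with_proj H) \<and> K\<^bsub>1,4\<^esub> (with_proj D)"
  shows "(\<exists>G :: nat pair_pre_digraph. locally_linear G \<and>
       digraph_iso (with_proj (triangle_graph G)) (with_proj H)) \<and>
    (\<forall>(G :: 'b pair_pre_digraph) (G' :: 'c pair_pre_digraph).
       locally_linear G \<and> digraph_iso (with_proj (triangle_graph G)) (with_proj H) \<and>
       locally_linear G' \<and> digraph_iso (with_proj (triangle_graph G')) (with_proj H) \<longrightarrow>
         digraph_iso (with_proj G) (with_proj G'))"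
proof (intro conjI allI impI; (elim conjE)?)
  interpret K4e_K14_free H
    using assms by (intro K4e_K14_free.intro K4e_K14_free_axioms.intro)
  show "\<exists>G :: nat pair_pre_digraph. locally_linear G \<and>
      digraph_iso (with_proj (triangle_graph G)) (with_proj H)"
    by (rule ex_locally_linear)
  fix G :: "'b pair_pre_digraph" and G' :: "'c pair_pre_digraph"
  assume G: "locally_linear G" "digraph_iso (with_proj (triangle_graph G)) (with_proj H)"
    and G': "locally_linear G'" "digraph_iso (with_proj (triangle_graph G')) (with_proj H)"
  \<comment> \<open>Well-formedness is needed to reverse the second isomorphism before composing
    through \<open>H\<close>.\<close>
  have "wf_digraph (with_proj (triangle_graph G'))"
    unfolding wf_digraph_wp_iff by unfold_locales (auto simp: triangle_graph_def)
  then have "digraph_iso (with_proj H) (with_proj (triangle_graph G'))"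
    using G'(2) by (rule digraph_iso_swap)
  then show "digraph_iso (with_proj G) (with_proj G')"
    using locally_linear_iso_of_triangle_graph_iso[OF G(1) G'(1)] digraph_iso_trans[OF G(2)] by blast
qed

end
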